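(* Let $l\ge 2$ be an even integer and let $\hat{\mathfrak g}$ be the affine Lie algebra of type $A_l^{(1)}$. The weight $\lambda=-\tfrac12(l+1)\Lambda_0$ is admissible and $$\hat\Pi^\vee_\lambda=\{(2\delta-\theta)^\vee,\alpha_1^\vee,\alpha_2^\vee,\dots,\alpha_l^\vee\}.$$
   Context: $\mathfrak g$ is the simple complex Lie algebra of type $A_l$ with simple roots $\alpha_1,\dots,\alpha_l$, highest root $\theta=\alpha_1+\cdots+\alpha_l$, and $\hat{\mathfrak g}$ is the associated affine Lie algebra with Cartan subalgebra $\hat{\mathfrak h}$, simple roots $\alpha_0,\alpha_1,\dots,\alpha_l$, canonical imaginary root $\delta=\alpha_0+\theta$, simple coroots $\alpha_0^\vee,\dots,\alpha_l^\vee$, canonical central element $c=\alpha_0^\vee+\cdots+\alpha_l^\vee$. $\Lambda_0$ is the fundamental weight with $\langle\Lambda_0,\alpha_0^\vee\rangle=1$ and $\langle\Lambda_0,\alpha_i^\vee\rangle=0$ for $1\le i\le l$, and $\rho$ satisfies $\langle\rho,\alpha_i^\vee\rangle=1$ for $0\le i\le l$. The real roots are $\alpha+m\delta$ ($\alpha$ a root of $\mathfrak g$, $m\in\mathbb Z$), positive if $m>0$, or $m=0$ and $\alpha$ is positive; the coroot of $\alpha+m\delta$ is $\alpha^\vee+mc$. $\hat\Delta^{\vee\,\mathrm{re}}$ (resp. $\hat\Delta^{\vee\,\mathrm{re}}_+$) $\subset\hat{\mathfrak h}$ is the set of real (resp. positive real) coroots and $\hat\Pi^\vee$ the set of simple coroots.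 For $\lambda\in\hat{\mathfrak h}^*$ put $\hat\Delta^{\vee\,\mathrm{re}}_\lambda=\{\alpha\in\hat\Delta^{\vee\,\mathrm{re}} : \langle\lambda,\alpha\rangle\in\mathbb Z\}$, $\hat\Delta^{\vee\,\mathrm{re}}_{\lambda+}=\hat\Delta^{\vee\,\mathrm{re}}_\lambda\cap\hat\Delta^{\vee\,\mathrm{re}}_+$, and let $\hat\Pi^\vee_\lambda$ be the set of $\alpha\in\hat\Delta^{\vee\,\mathrm{re}}_{\lambda+}$ not equal to a sum of several (two or more) coroots from $\hat\Delta^{\vee\,\mathrm{re}}_{\lambda+}$. The weight $\lambda$ is called admissible if $\langle\lambda+\rho,\alpha\rangle\notin-\mathbb Z_+$ for all $\alpha\in\hat\Delta^{\vee\,\mathrm{re}}_+$ and $\mathbb Q\hat\Delta^{\vee\,\mathrm{re}}_\lambda=\mathbb Q\hat\Pi^\vee$ (equality of $\mathbb Q$-spans). $\mathbb Z_+$ is the set of nonnegative integers. *)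

theory Defs
  imports
    Complex_Main
    "HOL-Library.Function_Algebras"
    "HOL-Library.Product_Plus"
    "HOL-Library.Nonpos_Ints"
begin

text \<open>
  The affine Lie algebra of type \<open>A\<^sub>l\<^sup>(\<^sup>1\<^sup>)\<close> is realised as
  \<open>sl\<^sub>l\<^sub>+\<^sub>1 \<otimes> \<complex>[t, t\<inverse>] \<oplus> \<complex>c \<oplus> \<complex>d\<close>.  The triple \<open>(X, a, b)\<close> stands for
  \<open>(\<Sum>m. X m \<otimes> t\<^sup>m) + a c + b d\<close>; the coefficients \<open>X m\<close> are matrices with rows and columns
  indexed by \<open>1, \<dots>, l + 1\<close> (and zero entries elsewhere).
\<close>

type_synonym cmat = "nat \<Rightarrow> nat \<Rightarrow> complex"
type_synonym aff = "(int \<Rightarrow> cmat) \<times> complex \<times> complex"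

definition mat_mult :: "nat \<Rightarrow> cmat \<Rightarrow> cmat \<Rightarrow> cmat" where
  "mat_mult l A B = (\<lambda>i j. \<Sum>k=1..l+1. A i k * B k j)"

definition mat_trace :: "nat \<Rightarrow> cmat \<Rightarrow> complex" where
  "mat_trace l A = (\<Sum>i=1..l+1. A i i)"

definition sl :: "nat \<Rightarrow> cmat set" where
  "sl l = {A. (\<forall>i j. A i j \<noteq> 0 \<longrightarrow> i \<in> {1..l+1} \<and> j \<in> {1..l+1}) \<and> mat_trace l A = 0}"

definition affine_alg :: "nat \<Rightarrow> aff set" where
  "affine_alg l = {(X, a, b). finite {m. X m \<noteq> 0} \<and> (\<forall>m. X m \<in> sl l)}"

definition cscale :: "complex \<Rightarrow> aff \<Rightarrow> aff" where
  "cscale z = (\<lambda>(X, a, b). (\<lambda>m i j. z * X m i j, z * a, z * b))"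

text \<open>
  \<open>[X t\<^sup>m, Y t\<^sup>n] = [X, Y] t\<^sup>m\<^sup>+\<^sup>n + m \<delta>\<^sub>m\<^sub>,\<^sub>-\<^sub>n tr(XY) c\<close>, \<open>[d, X t\<^sup>m] = m X t\<^sup>m\<close>, \<open>c\<close> central.
\<close>
definition bracket :: "nat \<Rightarrow> aff \<Rightarrow> aff \<Rightarrow> aff" where
  "bracket l = (\<lambda>(X, a, b) (Y, a', b').
     (\<lambda>k i j. (\<Sum>m | X m \<noteq> 0. mat_mult l (X m) (Y (k - m)) i j - mat_mult l (Y (k - m)) (X m) i j)
              + b * of_int k * Y k i j - b' * of_int k * X k i j,
      \<Sum>m | X m \<noteq> 0. of_int m * mat_trace l (mat_mult l (X m) (Y (- m))),
      0))"

definition central :: aff where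
  "central = (0, 1, 0)"

definition finite_alg :: "nat \<Rightarrow> aff set" where
  "finite_alg l = {(X, a, b) \<in> affine_alg l. (\<forall>m. m \<noteq> 0 \<longrightarrow> X m = 0) \<and> a = 0 \<and> b = 0}"

definition cartan :: "nat \<Rightarrow> aff set" where
  "cartan l = {(X, a, b) \<in> affine_alg l.
     (\<forall>m. m \<noteq> 0 \<longrightarrow> X m = 0) \<and> (\<forall>i j. i \<noteq> j \<longrightarrow> X 0 i j = 0)}"

text \<open>Functionals on the Cartan subalgebra are normalised to vanish outside it, so that equality
  of functionals is equality of functions.\<close>
definition cartan_dual :: "nat \<Rightarrow> (aff \<Rightarrow> complex) set" where
  "cartan_dual l = {f.
     (\<forall>x\<in>cartan l. \<forall>y\<in>cartan l. f (x + y) = f x + f y) \<and>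
     (\<forall>z. \<forall>x\<in>cartan l. f (cscale z x) = z * f x) \<and>
     (\<forall>x. x \<notin> cartan l \<longrightarrow> f x = 0)}"

definition root_space :: "nat \<Rightarrow> (aff \<Rightarrow> complex) \<Rightarrow> aff set" where
  "root_space l \<alpha> = {x \<in> finite_alg l. \<forall>h\<in>cartan l. bracket l h x = cscale (\<alpha> h) x}"

text \<open>As usual, roots of the finite-dimensional algebra are extended by zero on \<open>c\<close> and \<open>d\<close>; this
  is forced by \<open>c\<close> and \<open>d\<close> commuting with \<open>finite_alg\<close>.\<close>
definition finite_roots :: "nat \<Rightarrow> (aff \<Rightarrow> complex) set" where
  "finite_roots l = {\<alpha> \<in> cartan_dual l. \<alpha> \<noteq> 0 \<and> root_space l \<alpha> \<noteq> {0}}"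

text \<open>Root spaces are one-dimensional, so the set of brackets below is already a line.\<close>
definition finite_coroot :: "nat \<Rightarrow> (aff \<Rightarrow> complex) \<Rightarrow> aff" where
  "finite_coroot l \<alpha> = (THE h. h \<in> cartan l \<and> \<alpha> h = 2 \<and>
     (\<exists>x\<in>root_space l \<alpha>. \<exists>y\<in>root_space l (- \<alpha>). h = bracket l x y))"

definition finite_simple_root :: "nat \<Rightarrow> nat \<Rightarrow> aff \<Rightarrow> complex" where
  "finite_simple_root l i h =
     (if h \<in> cartan l then fst h 0 i i - fst h 0 (i + 1) (i + 1) else 0)"

definition finite_pos_roots :: "nat \<Rightarrow> (aff \<Rightarrow> complex) set" where
  "finite_pos_roots l = {\<alpha> \<in> finite_roots l.
     \<exists>n :: nat \<Rightarrow> nat. \<alpha> = (\<lambda>h. \<Sum>i=1..l. of_nat (n i) * finite_simple_root l i h)}"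

definition theta :: "nat \<Rightarrow> aff \<Rightarrow> complex" where
  "theta l = (\<Sum>i=1..l. finite_simple_root l i)"

definition delta :: "nat \<Rightarrow> aff \<Rightarrow> complex" where
  "delta l h = (if h \<in> cartan l then snd (snd h) else 0)"

definition simple_root :: "nat \<Rightarrow> nat \<Rightarrow> aff \<Rightarrow> complex" where
  "simple_root l i = (if i = 0 then delta l - theta l else finite_simple_root l i)"

definition shift_root :: "nat \<Rightarrow> (aff \<Rightarrow> complex) \<Rightarrow> int \<Rightarrow> aff \<Rightarrow> complex" where
  "shift_root l \<alpha> m = (\<lambda>h. \<alpha> h + of_int m * delta l h)"

definition real_roots :: "nat \<Rightarrow> (aff \<Rightarrow> complex) set" where
  "real_roots l = {shift_root l \<alpha> m | \<alpha> m. \<alpha> \<in> finite_roots l}"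

definition pos_real_roots :: "nat \<Rightarrow> (aff \<Rightarrow> complex) set" where
  "pos_real_roots l =
     {shift_root l \<alpha> m | \<alpha> m. \<alpha> \<in> finite_roots l \<and> (m > 0 \<or> m = 0 \<and> \<alpha> \<in> finite_pos_roots l)}"

text \<open>\<open>(\<alpha> + m \<delta>)\<^sup>\<or> = \<alpha>\<^sup>\<or> + m c\<close>\<close>
definition coroot :: "nat \<Rightarrow> (aff \<Rightarrow> complex) \<Rightarrow> aff" where
  "coroot l \<beta> = (THE h. \<exists>\<alpha>\<in>finite_roots l. \<exists>m. \<beta> = shift_root l \<alpha> m \<and>
     h = finite_coroot l \<alpha> + cscale (of_int m) central)"

definition simple_coroot :: "nat \<Rightarrow> nat \<Rightarrow> aff" where
  "simple_coroot l i = coroot l (simple_root l i)"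

definition real_coroots :: "nat \<Rightarrow> aff set" where
  "real_coroots l = coroot l ` real_roots l"

definition pos_real_coroots :: "nat \<Rightarrow> aff set" where
  "pos_real_coroots l = coroot l ` pos_real_roots l"

definition integral_coroots :: "nat \<Rightarrow> (aff \<Rightarrow> complex) \<Rightarrow> aff set" where
  "integral_coroots l \<mu> = {\<alpha> \<in> real_coroots l. \<mu> \<alpha> \<in> \<int>}"

definition pos_integral_coroots :: "nat \<Rightarrow> (aff \<Rightarrow> complex) \<Rightarrow> aff set" where
  "pos_integral_coroots l \<mu> = integral_coroots l \<mu> \<inter> pos_real_coroots l"

text \<open>Repeated summands are allowed in a sum of several coroots.\<close>
definition integral_simple_coroots :: "nat \<Rightarrow> (aff \<Rightarrow> complex) \<Rightarrow> aff set" where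
  "integral_simple_coroots l \<mu> = {\<alpha> \<in> pos_integral_coroots l \<mu>.
     \<not> (\<exists>xs. length xs \<ge> 2 \<and> set xs \<subseteq> pos_integral_coroots l \<mu> \<and> \<alpha> = sum_list xs)}"

interpretation rat_space: vector_space "\<lambda>q :: rat. cscale (of_rat q)"
  by unfold_locales
    (simp_all add: cscale_def split_beta prod_eq_iff fun_eq_iff algebra_simps of_rat_add of_rat_mult)

text \<open>\<open>\<rho>\<close> and the fundamental weight are determined only up to adding multiples of \<open>\<delta>\<close>, and
  \<open>\<delta>\<close> vanishes on all real coroots.\<close>
definition is_rho :: "nat \<Rightarrow> (aff \<Rightarrow> complex) \<Rightarrow> bool" where
  "is_rho l \<rho> \<longleftrightarrow> \<rho> \<in> cartan_dual l \<and> (\<forall>i\<le>l. \<rho> (simple_coroot l i) = 1)"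

definition is_Lambda0 :: "nat \<Rightarrow> (aff \<Rightarrow> complex) \<Rightarrow> bool" where
  "is_Lambda0 l \<Lambda> \<longleftrightarrow> \<Lambda> \<in> cartan_dual l \<and> \<Lambda> (simple_coroot l 0) = 1 \<and>
     (\<forall>i\<in>{1..l}. \<Lambda> (simple_coroot l i) = 0)"

definition admissible :: "nat \<Rightarrow> (aff \<Rightarrow> complex) \<Rightarrow> (aff \<Rightarrow> complex) \<Rightarrow> bool" where
  "admissible l \<rho> \<mu> \<longleftrightarrow> \<mu> \<in> cartan_dual l \<and>
     (\<forall>\<alpha>\<in>pos_real_coroots l. (\<mu> + \<rho>) \<alpha> \<notin> \<int>\<^sub>\<le>\<^sub>0) \<and>
     rat_space.span (integral_coroots l \<mu>) = rat_space.span (simple_coroot l ` {0..l})"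

end

theory Submission
  imports Defs
begin

text \<open>
  With \<open>E\<^sub>i\<close> the \<open>i\<close>-th diagonal matrix unit, the real coroots are \<open>E\<^sub>i - E\<^sub>j + m c\<close>
  with \<open>i \<noteq> j\<close>.  On them \<open>\<lambda>\<close> takes the value \<open>- (l + 1) m / 2\<close> and \<open>\<rho>\<close> the
  value \<open>j - i + (l + 1) m\<close>.  As \<open>l + 1\<close> is odd, integrality means that \<open>m\<close> is even.  On the positive
  coroots \<open>\<lambda> + \<rho> = j - i + (l + 1) m / 2\<close> is not an integer when \<open>m = 1\<close>, and is at least 1 when \<open>m \<noteq> 1\<close>.  So \<open>\<lambda> + \<rho>\<close> is an additive height on the
  integral positive coroots with values in the positive integers; it is 1 on the asserted simple
  coroots, which are therefore indecomposable, and every other integral positive coroot splits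
  explicitly.
\<close>

subsection \<open>Root spaces and coroots in matrix form\<close>

definition diag_elt :: "(nat \<Rightarrow> complex) \<Rightarrow> complex \<Rightarrow> complex \<Rightarrow> aff" where
  "diag_elt d a b = ((\<lambda>k p q. if k = 0 \<and> p = q then d p else 0), a, b)"

definition unit_elt :: "complex \<Rightarrow> nat \<Rightarrow> nat \<Rightarrow> aff" where
  "unit_elt z i j = ((\<lambda>k p q. if k = 0 \<and> p = i \<and> q = j then z else 0), 0, 0)"

text \<open>The functional e_i - e_j, cut off outside the Cartan subalgebra because equality of
  functionals is equality of functions.\<close>

definition diff_root :: "nat \<Rightarrow> nat \<Rightarrow> nat \<Rightarrow> aff \<Rightarrow> complex" where
  "diff_root l i j h = (if h \<in> cartan l then fst h 0 i i - fst h 0 j j else 0)"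

definition diff_coroot :: "nat \<Rightarrow> nat \<Rightarrow> int \<Rightarrow> aff" where
  "diff_coroot i j m = diag_elt (\<lambda>p. of_bool (p = i) - of_bool (p = j)) (of_int m) 0"

section \<open>The Cartan subalgebra and difference functionals\<close>

lemma diag_elt_in_cartan:
  assumes "\<And>p. p \<notin> {1..l+1} \<Longrightarrow> d p = 0" and "(\<Sum>p=1..l+1. d p) = 0"
  shows "diag_elt d a b \<in> cartan l"
proof -
  have fin: "finite {m::int. (\<lambda>p q. if m = 0 \<and> p = q then d p else 0) \<noteq> (0 :: cmat)}"
    by (rule finite_subset[of _ "{0}"]) (auto simp: fun_eq_iff)
  have sl0: "(\<lambda>p q. if m = 0 \<and> p = q then d p else 0) \<in> sl l" for m :: int
    using assms unfolding sl_def mat_trace_def by (cases "m = 0") (auto split: if_splits)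
  show ?thesis
    using fin sl0 unfolding cartan_def affine_alg_def diag_elt_def by (auto simp: fun_eq_iff)
qed

lemma diff_coroot_in_cartan:
  assumes "i \<in> {1..l+1}" "j \<in> {1..l+1}"
  shows "diff_coroot i j m \<in> cartan l"
  unfolding diff_coroot_def
proof (rule diag_elt_in_cartan)
  show "(\<Sum>p=1..l+1. of_bool (p = i) - of_bool (p = j) :: complex) = 0"
    using assms by (simp add: sum_subtractf of_bool_def)
qed (use assms in auto)

lemma cartan_diag:
  assumes "h \<in> cartan l"
  shows "k \<noteq> 0 \<Longrightarrow> fst h k = 0" and "p \<noteq> q \<Longrightarrow> fst h k p q = 0"
    and "p \<notin> {1..l+1} \<Longrightarrow> fst h k p q = 0"
proof -
  show *: "fst h k = 0" if "k \<noteq> 0" for k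
    using assms that by (auto simp: cartan_def)
  show "fst h k p q = 0" if "p \<noteq> q"
    using assms that * by (cases "k = 0") (auto simp: cartan_def)
  show "fst h k p q = 0" if "p \<notin> {1..l+1}"
    using assms that unfolding cartan_def affine_alg_def sl_def by fastforce
qed

text \<open>Both summands are diagonal elements, so \<open>diag_elt_in_cartan\<close> takes care of
  the finite support and leaves only the index range and the trace.\<close>

lemma cartan_add: "x \<in> cartan l \<Longrightarrow> y \<in> cartan l \<Longrightarrow> x + y \<in> cartan l"
proof -
  assume x: "x \<in> cartan l" and y: "y \<in> cartan l"
  have eq: "z = diag_elt (\<lambda>p. fst z 0 p p) (fst (snd z)) (snd (snd z))"
    if "z \<in> cartan l" for z
    using cartan_diag[OF that] by (auto simp: diag_elt_def prod_eq_iff fun_eq_iff)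
  have tr: "(\<Sum>p=1..l+1. fst z 0 p p) = 0" if "z \<in> cartan l" for z
    using that unfolding cartan_def affine_alg_def sl_def mat_trace_def by auto
  have "x + y = diag_elt (\<lambda>p. fst x 0 p p + fst y 0 p p)
      (fst (snd x) + fst (snd y)) (snd (snd x) + snd (snd y))"
    by (subst eq[OF x], subst eq[OF y]) (auto simp: diag_elt_def prod_eq_iff fun_eq_iff)
  also have "\<dots> \<in> cartan l"
    by (rule diag_elt_in_cartan)
      (use tr[OF x] tr[OF y] in \<open>simp_all add: cartan_diag[OF x] cartan_diag[OF y] sum.distrib\<close>)
  finally show ?thesis .
qed

lemma cartan_cscale: "x \<in> cartan l \<Longrightarrow> cscale z x \<in> cartan l"
proof -
  assume x: "x \<in> cartan l"
  have tr: "(\<Sum>p=1..l+1. fst x 0 p p) = 0"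
    using x unfolding cartan_def affine_alg_def sl_def mat_trace_def by auto
  have "cscale z x = diag_elt (\<lambda>p. z * fst x 0 p p) (z * fst (snd x)) (z * snd (snd x))"
    using cartan_diag[OF x] by (auto simp: diag_elt_def cscale_def split_beta fun_eq_iff)
  also have "\<dots> \<in> cartan l"
    by (rule diag_elt_in_cartan)
      (use tr in \<open>simp_all add: cartan_diag[OF x] flip: sum_distrib_left\<close>)
  finally show ?thesis .
qed

lemma diff_root_in_cartan_dual: "diff_root l i j \<in> cartan_dual l"
  unfolding cartan_dual_def diff_root_def
  by (auto simp: cartan_add cartan_cscale) (auto simp: cscale_def split_beta algebra_simps)

lemma diff_root_diff_coroot:
  assumes "i \<in> {1..l+1}" "j \<in> {1..l+1}"
  shows "diff_root l p q (diff_coroot i j m)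
    = (of_bool (p = i) - of_bool (p = j)) - (of_bool (q = i) - of_bool (q = j))"
  using diff_coroot_in_cartan[OF assms] by (simp add: diff_root_def diff_coroot_def diag_elt_def)

text \<open>At E_i - E_j the right-hand functional takes the value 2. The left one is a difference
  of two numbers in {-1, 0, 1}, and it reaches 2 only for \<open>p = i\<close> and
  \<open>q = j\<close>.\<close>

lemma diff_root_inject:
  assumes "i \<in> {1..l+1}" "j \<in> {1..l+1}" "i \<noteq> j" and eq: "diff_root l p q = diff_root l i j"
  shows "p = i \<and> q = j"
proof -
  have "diff_root l p q (diff_coroot i j 0) = 2"
    unfolding eq using assms by (simp add: diff_root_diff_coroot)
  then show ?thesis
    using assms(1-3) by (auto simp: diff_root_diff_coroot of_bool_def split: if_splits)
qed

lemma minus_diff_root: "- diff_root l i j = diff_root l j i"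
  by (auto simp: diff_root_def fun_eq_iff)

section \<open>Brackets in degree zero\<close>

text \<open>The bracket sums over the support of its first argument. For an element of degree 0 this
  support is {0} or empty, and the second premise reconciles the empty sum with the degree 0
  term.\<close>

lemma sum_support_zero:
  fixes X :: "int \<Rightarrow> cmat" and F :: "int \<Rightarrow> complex"
  assumes "\<And>m. m \<noteq> 0 \<Longrightarrow> X m = 0" and "X 0 = 0 \<Longrightarrow> F 0 = 0"
  shows "(\<Sum>m | X m \<noteq> 0. F m) = F 0"
proof (cases "X 0 = 0")
  case True
  then have "X m = 0" for m using assms(1) by (cases "m = 0") auto
  then show ?thesis using assms(2) by simp
next
  case False
  then have "{m. X m \<noteq> 0} = {0}" using assms(1) by auto
  then show ?thesis by simp
qed

text \<open>A diagonal matrix multiplies the entry (p, q) by its p-th diagonal entry from the left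
  and by its q-th from the right. The central term carries the factor \<open>m = 0\<close>.\<close>

lemma bracket_cartan_finite_alg:
  assumes h: "h \<in> cartan l" and x: "x \<in> finite_alg l"
  shows "bracket l h x = ((\<lambda>k p q. (fst h 0 p p - fst h 0 q q) * fst x k p q), 0, 0)"
proof -
  obtain H a b where hh: "h = (H, a, b)" by (cases h)
  obtain X where xx: "x = (X, 0, 0)" and X0: "\<And>k. k \<noteq> 0 \<Longrightarrow> X k = 0"
    and Xsl: "\<And>k. X k \<in> sl l"
    using x by (cases x) (auto simp: finite_alg_def affine_alg_def)
  have H0: "\<And>k. k \<noteq> 0 \<Longrightarrow> H k = 0" and Hpq: "\<And>p q. p \<noteq> q \<Longrightarrow> H 0 p q = 0"
    and Hout: "\<And>p q. p \<notin> {1..l+1} \<Longrightarrow> H 0 p q = 0"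
    using cartan_diag[OF h] by (auto simp: hh)
  have Xout: "X k p q = 0" if "p \<notin> {1..l+1} \<or> q \<notin> {1..l+1}" for k p q
    using Xsl[of k] that unfolding sl_def by blast
  have left: "mat_mult l (H 0) (X k) p q = H 0 p p * X k p q" for k p q
  proof -
    have "mat_mult l (H 0) (X k) p q = (\<Sum>r=1..l+1. if r = p then H 0 p p * X k p q else 0)"
      unfolding mat_mult_def by (rule sum.cong) (auto simp: Hpq)
    then show ?thesis using Hout[of p p] by auto
  qed
  have right: "mat_mult l (X k) (H 0) p q = X k p q * H 0 q q" for k p q
  proof -
    have "mat_mult l (X k) (H 0) p q = (\<Sum>r=1..l+1. if r = q then X k p q * H 0 q q else 0)"
      unfolding mat_mult_def by (rule sum.cong) (auto simp: Hpq)
    then show ?thesis using Hout[of q q] by auto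
  qed
  have s1: "(\<Sum>m | H m \<noteq> 0. mat_mult l (H m) (X (k - m)) p q - mat_mult l (X (k - m)) (H m) p q)
      = (H 0 p p - H 0 q q) * X k p q" for k p q
  proof (subst sum_support_zero)
    show "mat_mult l (H 0) (X (k - 0)) p q - mat_mult l (X (k - 0)) (H 0) p q = 0" if "H 0 = 0"
      unfolding that mat_mult_def by simp
  qed (auto simp: H0 left right algebra_simps)
  have s2: "(\<Sum>m | H m \<noteq> 0. of_int m * mat_trace l (mat_mult l (H m) (X (- m)))) = 0"
    by (subst sum_support_zero) (auto simp: H0)
  \<comment> \<open>The derivation scales degree \<open>k\<close> by \<open>k\<close>, and
    \<open>x\<close> lives in degree 0.\<close>
  have s3: "b * of_int k * X k p q = 0" for k p q
    using X0[of k] by (cases "k = 0") auto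
  show ?thesis
    by (simp add: hh xx bracket_def s1 s2 s3 del: mult_eq_0_iff)
qed

lemma unit_elt_in_finite_alg:
  assumes "i \<in> {1..l+1}" "j \<in> {1..l+1}" "i \<noteq> j"
  shows "unit_elt z i j \<in> finite_alg l"
proof -
  have fin: "finite {m::int. (\<lambda>p q. if m = 0 \<and> p = i \<and> q = j then z else 0) \<noteq> (0 :: cmat)}"
    by (rule finite_subset[of _ "{0}"]) (auto simp: fun_eq_iff)
  have "(\<lambda>p q. if m = 0 \<and> p = i \<and> q = j then z else 0) \<in> sl l" for m :: int
    using assms unfolding sl_def mat_trace_def by (auto intro!: sum.neutral)
  with fin show ?thesis
    unfolding finite_alg_def affine_alg_def unit_elt_def by (auto simp: fun_eq_iff)
qed

text \<open>The matrix identity [z E_ij, w E_ji] = z w (E_ii - E_jj); no central term arises in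
  degree 0.\<close>

lemma bracket_unit_elt:
  assumes "i \<in> {1..l+1}" "j \<in> {1..l+1}"
  shows "bracket l (unit_elt z i j) (unit_elt w j i)
    = diag_elt (\<lambda>p. z * w * (of_bool (p = i) - of_bool (p = j))) 0 0"
proof -
  define X :: "complex \<Rightarrow> nat \<Rightarrow> nat \<Rightarrow> int \<Rightarrow> cmat" where
    "X = (\<lambda>z i j k p q. if k = 0 \<and> p = i \<and> q = j then z else 0)"
  have unit: "unit_elt z i j = (X z i j, 0, 0)" for z i j
    by (simp add: unit_elt_def X_def)
  have X0: "X z i j k = 0" if "k \<noteq> 0" for z i j k
    using that by (auto simp: X_def fun_eq_iff)
  have mm: "mat_mult l (X z i j 0) (X w j i k) p q
      = (if k = 0 \<and> p = q \<and> p = i then z * w else 0)"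
    if "j \<in> {1..l+1}" for z w i j k p q
  proof -
    have "mat_mult l (X z i j 0) (X w j i k) p q
        = (\<Sum>r=1..l+1. if r = j then (if k = 0 \<and> p = q \<and> p = i then z * w else 0) else 0)"
      unfolding mat_mult_def by (rule sum.cong) (auto simp: X_def)
    then show ?thesis using that by auto
  qed
  have mm': "mat_mult l (X w j i k) (X z i j 0) p q
      = (if k = 0 \<and> p = q \<and> p = j then z * w else 0)" for k p q
    using mm[OF assms(1), of w j z 0 p q] X0[of k]
    by (cases "k = 0") (auto simp: mat_mult_def)
  have s1: "(\<Sum>m | X z i j m \<noteq> 0. mat_mult l (X z i j m) (X w j i (k - m)) p q
        - mat_mult l (X w j i (k - m)) (X z i j m) p q)
      = (if k = 0 \<and> p = q then z * w * (of_bool (p = i) - of_bool (p = j)) else 0)" for k p q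
  proof (subst sum_support_zero)
    show "mat_mult l (X z i j 0) (X w j i (k - 0)) p q
        - mat_mult l (X w j i (k - 0)) (X z i j 0) p q = 0" if "X z i j 0 = 0"
      unfolding that mat_mult_def by simp
  qed (use assms in \<open>auto simp: X0 mm mm'\<close>)
  have s2: "(\<Sum>m | X z i j m \<noteq> 0.
      of_int m * mat_trace l (mat_mult l (X z i j m) (X w j i (- m)))) = 0"
    by (subst sum_support_zero) (auto simp: X0)
  show ?thesis
    by (simp add: unit s1 s2 diag_elt_def bracket_def)
qed

section \<open>Roots and coroots of the finite-dimensional algebra\<close>

text \<open>Each \<open>h\<close> scales the entry (p, q) by \<open>diff_root l p q h\<close>, so
  the eigenvector equation can be read entry by entry and constrains \<alpha> only at the nonzero
  entries.\<close>

lemma root_space_iff: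
  assumes "x \<in> finite_alg l"
  shows "x \<in> root_space l \<alpha> \<longleftrightarrow>
    (\<forall>h\<in>cartan l. \<forall>p q. fst x 0 p q \<noteq> 0 \<longrightarrow> \<alpha> h = diff_root l p q h)"
proof -
  obtain X where xx: "x = (X, 0, 0)" and X0: "\<And>k. k \<noteq> 0 \<Longrightarrow> X k = 0"
    using assms by (cases x) (auto simp: finite_alg_def affine_alg_def)
  have "bracket l h x = cscale (\<alpha> h) x \<longleftrightarrow>
      (\<forall>p q. fst x 0 p q \<noteq> 0 \<longrightarrow> \<alpha> h = diff_root l p q h)" if h: "h \<in> cartan l" for h
  proof -
    have "bracket l h x = cscale (\<alpha> h) x \<longleftrightarrow>
        (\<forall>k p q. diff_root l p q h * X k p q = \<alpha> h * X k p q)"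
      unfolding bracket_cartan_finite_alg[OF h assms]
      using h by (auto simp: cscale_def xx fun_eq_iff diff_root_def)
    also have "\<dots> \<longleftrightarrow> (\<forall>p q. diff_root l p q h * X 0 p q = \<alpha> h * X 0 p q)"
      using X0 by (metis mult_zero_right zero_fun_apply)
    finally show ?thesis using xx by auto metis
  qed
  then show ?thesis using assms by (simp add: root_space_def)
qed

lemma cartan_dual_eqI:
  assumes "f \<in> cartan_dual l" "g \<in> cartan_dual l" "\<And>h. h \<in> cartan l \<Longrightarrow> f h = g h"
  shows "f = g"
proof
  fix h
  have "f h = 0 \<and> g h = 0" if "h \<notin> cartan l"
    using assms(1,2) that unfolding cartan_dual_def by blast
  then show "f h = g h" using assms(3) by (cases "h \<in> cartan l") simp_all
qed

text \<open>Different index pairs have different weights by \<open>diff_root_inject\<close>, so a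
  root vector has no nonzero entry besides (i, j).\<close>

lemma root_space_diff_root:
  assumes "i \<in> {1..l+1}" "j \<in> {1..l+1}" "i \<noteq> j"
  shows "root_space l (diff_root l i j) = range (\<lambda>z. unit_elt z i j)"
proof (intro equalityI subsetI)
  fix x assume x: "x \<in> root_space l (diff_root l i j)"
  then have fa: "x \<in> finite_alg l" by (simp add: root_space_def)
  have "p = i \<and> q = j" if "fst x 0 p q \<noteq> 0" for p q
  proof -
    have "diff_root l i j h = diff_root l p q h" if "h \<in> cartan l" for h
      using x \<open>fst x 0 p q \<noteq> 0\<close> that unfolding root_space_iff[OF fa] by blast
    then have "diff_root l i j = diff_root l p q"
      by (rule cartan_dual_eqI[OF diff_root_in_cartan_dual diff_root_in_cartan_dual])
    then show ?thesis using diff_root_inject[OF assms, of p q] by simp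
  qed
  moreover obtain X where xx: "x = (X, 0, 0)" and X0: "\<And>k. k \<noteq> 0 \<Longrightarrow> X k = 0"
    using fa by (cases x) (auto simp: finite_alg_def)
  ultimately have "X k p q = (if k = 0 \<and> p = i \<and> q = j then X 0 i j else 0)" for k p q
    by (cases "k = 0") auto
  then have "x = unit_elt (X 0 i j) i j" unfolding xx unit_elt_def by (intro prod_eqI ext) simp_all
  then show "x \<in> range (\<lambda>z. unit_elt z i j)" by blast
next
  fix x assume "x \<in> range (\<lambda>z. unit_elt z i j)"
  then obtain z where x: "x = unit_elt z i j" by blast
  show "x \<in> root_space l (diff_root l i j)"
    using root_space_iff[OF unit_elt_in_finite_alg[OF assms]] unfolding x
    by (auto simp: unit_elt_def split: if_splits)
qed

text \<open>A single nonzero entry (i, j) of a root vector determines the root, and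
  \<open>i = j\<close> would make that root zero. Conversely E_ij is a root vector.\<close>

lemma finite_roots_eq:
  "finite_roots l = {diff_root l i j | i j. i \<in> {1..l+1} \<and> j \<in> {1..l+1} \<and> i \<noteq> j}"
proof (intro equalityI subsetI)
  fix \<alpha> assume a: "\<alpha> \<in> finite_roots l"
  have zero: "0 \<in> root_space l \<alpha>"
  proof -
    have "0 \<in> finite_alg l"
      by (auto simp: finite_alg_def affine_alg_def sl_def mat_trace_def zero_prod_def)
    then show ?thesis by (simp add: root_space_iff)
  qed
  with a obtain x where x: "x \<in> root_space l \<alpha>" "x \<noteq> 0"
    unfolding finite_roots_def by blast
  then have fa: "x \<in> finite_alg l" by (simp add: root_space_def)
  obtain X where xx: "x = (X, 0, 0)" and X0: "\<And>k. k \<noteq> 0 \<Longrightarrow> X k = 0" and sl: "X 0 \<in> sl l"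
    using fa by (cases x) (auto simp: finite_alg_def affine_alg_def)
  have "X 0 \<noteq> 0"
  proof
    assume "X 0 = 0"
    then have "X k = 0" for k using X0 by (cases "k = 0") auto
    then show False using x xx by (auto simp: fun_eq_iff zero_prod_def)
  qed
  then obtain i j where ij: "X 0 i j \<noteq> 0" by (auto simp: fun_eq_iff)
  have "\<alpha> h = diff_root l i j h" if "h \<in> cartan l" for h
    using x(1) ij that unfolding root_space_iff[OF fa] by (simp add: xx)
  then have eq: "\<alpha> = diff_root l i j"
    using a diff_root_in_cartan_dual by (intro cartan_dual_eqI) (auto simp: finite_roots_def)
  moreover have "i \<noteq> j"
  proof
    assume "i = j"
    then have "\<alpha> = 0" unfolding eq diff_root_def by (intro ext) simp
    then show False using a by (simp add: finite_roots_def)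
  qed
  ultimately show "\<alpha> \<in> {diff_root l i j | i j. i \<in> {1..l+1} \<and> j \<in> {1..l+1} \<and> i \<noteq> j}"
    using ij sl unfolding sl_def by blast
next
  fix \<alpha> assume "\<alpha> \<in> {diff_root l i j | i j. i \<in> {1..l+1} \<and> j \<in> {1..l+1} \<and> i \<noteq> j}"
  then obtain i j where ij: "i \<in> {1..l+1}" "j \<in> {1..l+1}" "i \<noteq> j" and a: "\<alpha> = diff_root l i j"
    by blast
  have "diff_root l i j (diff_coroot i j 0) = 2" using ij by (simp add: diff_root_diff_coroot)
  then have "\<alpha> \<noteq> 0" by (auto simp: a)
  moreover have "unit_elt 1 i j \<in> root_space l \<alpha>"
    using root_space_diff_root[OF ij] by (simp add: a)
  moreover have "unit_elt 1 i j \<noteq> 0"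
    by (auto simp: unit_elt_def zero_prod_def fun_eq_iff)
  ultimately show "\<alpha> \<in> finite_roots l"
    using diff_root_in_cartan_dual by (auto simp: finite_roots_def a)
qed

text \<open>All brackets of the two root spaces are multiples of E_i - E_j, and the normalisation
  \<open>\<alpha> h = 2\<close> singles out the multiple 1.\<close>

lemma finite_coroot_diff_root:
  assumes "i \<in> {1..l+1}" "j \<in> {1..l+1}" "i \<noteq> j"
  shows "finite_coroot l (diff_root l i j) = diff_coroot i j 0"
proof -
  have D: "diff_coroot i j 0 \<in> cartan l" "diff_root l i j (diff_coroot i j 0) = 2"
    using diff_coroot_in_cartan assms by (auto simp: diff_root_diff_coroot)
  have br: "bracket l (unit_elt z i j) (unit_elt w j i) = cscale (z * w) (diff_coroot i j 0)" for z w
    unfolding bracket_unit_elt[OF assms(1,2)]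
    by (auto simp: diff_coroot_def diag_elt_def cscale_def fun_eq_iff)
  have one: "cscale 1 x = x" for x by (simp add: cscale_def split_beta)
  show ?thesis
    unfolding finite_coroot_def minus_diff_root root_space_diff_root[OF assms]
      root_space_diff_root[OF assms(2,1) assms(3)[symmetric]]
  proof (rule the_equality)
    have "diff_coroot i j 0 = bracket l (unit_elt 1 i j) (unit_elt 1 j i)"
      by (simp add: br one)
    then show "diff_coroot i j 0 \<in> cartan l \<and> diff_root l i j (diff_coroot i j 0) = 2 \<and>
        (\<exists>x\<in>range (\<lambda>z. unit_elt z i j). \<exists>y\<in>range (\<lambda>z. unit_elt z j i).
          diff_coroot i j 0 = bracket l x y)"
      using D by blast
  next
    fix h
    assume h: "h \<in> cartan l \<and> diff_root l i j h = 2 \<and>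
        (\<exists>x\<in>range (\<lambda>z. unit_elt z i j). \<exists>y\<in>range (\<lambda>z. unit_elt z j i). h = bracket l x y)"
    then obtain z w where hz: "h = cscale (z * w) (diff_coroot i j 0)"
      by (auto simp: br)
    have "diff_root l i j h = z * w * 2"
      using diff_root_in_cartan_dual[of l i j] D unfolding hz cartan_dual_def by auto
    with h have "z * w = 1" by simp
    then show "h = diff_coroot i j 0" by (simp add: hz one)
  qed
qed

section \<open>Real roots and coroots of the affine algebra\<close>

lemma shift_root_inject:
  assumes "i \<in> {1..l+1}" "j \<in> {1..l+1}" "i \<noteq> j"
    and eq: "shift_root l (diff_root l p q) n = shift_root l (diff_root l i j) m"
  shows "p = i \<and> q = j \<and> n = m"
proof -
  \<comment> \<open>This is the derivation d: finite roots vanish on it and \<delta> takes the value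
    1, so it reads off the multiple of \<delta>.\<close>
  have "diag_elt (\<lambda>_. 0) 0 1 \<in> cartan l" by (rule diag_elt_in_cartan) auto
  then have "n = m"
    using fun_cong[OF eq, of "diag_elt (\<lambda>_. 0) 0 1"]
    by (simp add: shift_root_def diff_root_def delta_def diag_elt_def)
  then have "diff_root l p q = diff_root l i j"
    using eq by (auto simp: shift_root_def fun_eq_iff)
  with \<open>n = m\<close> diff_root_inject[OF assms(1-3)] show ?thesis by blast
qed

lemma diff_coroot_shift: "diff_coroot i j 0 + cscale (of_int m) central = diff_coroot i j m"
  by (auto simp: diff_coroot_def diag_elt_def cscale_def central_def fun_eq_iff)

text \<open>The description in \<open>coroot\<close> has a unique solution because a real root
  determines its finite part and its multiple of \<delta>.\<close>

lemma coroot_shift_diff_root: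
  assumes "i \<in> {1..l+1}" "j \<in> {1..l+1}" "i \<noteq> j"
  shows "coroot l (shift_root l (diff_root l i j) m) = diff_coroot i j m"
  unfolding coroot_def
proof (rule the_equality)
  show "\<exists>\<alpha>\<in>finite_roots l. \<exists>n. shift_root l (diff_root l i j) m = shift_root l \<alpha> n \<and>
      diff_coroot i j m = finite_coroot l \<alpha> + cscale (of_int n) central"
  proof (intro bexI exI conjI)
    show "diff_root l i j \<in> finite_roots l" using assms unfolding finite_roots_eq by blast
  qed (auto simp: finite_coroot_diff_root[OF assms] diff_coroot_shift)
next
  fix h
  assume "\<exists>\<alpha>\<in>finite_roots l. \<exists>n. shift_root l (diff_root l i j) m = shift_root l \<alpha> n \<and>
      h = finite_coroot l \<alpha> + cscale (of_int n) central"
  then obtain p q n where pq: "p \<in> {1..l+1}" "q \<in> {1..l+1}" "p \<noteq> q"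
    and eq: "shift_root l (diff_root l i j) m = shift_root l (diff_root l p q) n"
    and h: "h = finite_coroot l (diff_root l p q) + cscale (of_int n) central"
    unfolding finite_roots_eq by blast
  then show "h = diff_coroot i j m"
    using shift_root_inject[OF pq eq] by (simp add: finite_coroot_diff_root diff_coroot_shift)
qed

lemma real_coroots_eq:
  "real_coroots l = {diff_coroot i j m | i j m. i \<in> {1..l+1} \<and> j \<in> {1..l+1} \<and> i \<noteq> j}"
proof -
  have "real_coroots l = {coroot l (shift_root l (diff_root l i j) m) | i j m.
      i \<in> {1..l+1} \<and> j \<in> {1..l+1} \<and> i \<noteq> j}"
    unfolding real_coroots_def real_roots_def finite_roots_eq by blast
  also have "\<dots> = {diff_coroot i j m | i j m. i \<in> {1..l+1} \<and> j \<in> {1..l+1} \<and> i \<noteq> j}"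
    by (intro Collect_cong iff_exI) (metis coroot_shift_diff_root)
  finally show ?thesis .
qed

section \<open>Simple and positive roots\<close>

lemma finite_simple_root_eq: "finite_simple_root l i = diff_root l i (i + 1)"
  by (auto simp: finite_simple_root_def diff_root_def)

text \<open>Telescoping sum of differences of consecutive diagonal entries.\<close>

lemma sum_simple_roots:
  assumes "i \<le> j"
  shows "(\<Sum>k=i..<j. finite_simple_root l k h) = diff_root l i j h"
  using sum_Suc_diff'[OF assms, of "\<lambda>k. - fst h 0 k k"]
  by (auto simp: finite_simple_root_def diff_root_def)

lemma theta_eq: "theta l = diff_root l 1 (l + 1)"
proof
  fix h
  \<comment> \<open>\<open>theta\<close> is a sum of functions, so its value has to be turned into a
    sum of values.\<close>
  have "sum F A h = (\<Sum>k\<in>A. F k h)" for F :: "nat \<Rightarrow> aff \<Rightarrow> complex" and A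
    by (induction A rule: infinite_finite_induct) auto
  then have "theta l h = (\<Sum>k=1..<l+1. finite_simple_root l k h)"
    unfolding theta_def by (simp add: atLeastLessThanSuc_atLeastAtMost)
  then show "theta l h = diff_root l 1 (l + 1) h" using sum_simple_roots[of 1 "l + 1" l h] by simp
qed

text \<open>A nonnegative combination of simple roots has nonnegative height, and
  \<open>diff_root l i j\<close> has height \<open>j - i\<close>. Conversely the telescoping sum has
  coefficient 1 exactly on \<open>{i..<j}\<close>.\<close>

lemma diff_root_in_finite_pos_roots_iff:
  assumes "i \<in> {1..l+1}" "j \<in> {1..l+1}" "i \<noteq> j"
  shows "diff_root l i j \<in> finite_pos_roots l \<longleftrightarrow> i < j"
proof
  assume "diff_root l i j \<in> finite_pos_roots l"
  then obtain n :: "nat \<Rightarrow> nat"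
    where n: "diff_root l i j = (\<lambda>h. \<Sum>k=1..l. of_nat (n k) * finite_simple_root l k h)"
    by (auto simp: finite_pos_roots_def)
  \<comment> \<open>Evaluate at the sum of the positive coroots, on which every simple root takes the value 2.\<close>
  define h where "h = diag_elt (\<lambda>p. if p \<in> {1..l+1} then of_nat (l + 2) - 2 * of_nat p else 0) 0 0"
  \<comment> \<open>At \<open>n = l + 1\<close> this sum vanishes, which is the trace condition for
    \<open>h\<close>.\<close>
  have "(\<Sum>p=1..n. complex_of_nat (l + 2) - 2 * of_nat p) = of_nat n * (of_nat l + 1 - of_nat n)" for n
    by (induction n) (auto simp: algebra_simps)
  from this[of "l + 1"] have h: "h \<in> cartan l"
    unfolding h_def by (intro diag_elt_in_cartan) auto
  have val: "diff_root l p q h = 2 * (of_nat q - of_nat p)" if "p \<in> {1..l+1}" "q \<in> {1..l+1}" for p q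
    using h that by (simp add: diff_root_def) (simp add: h_def diag_elt_def)
  have "2 * (of_nat j - of_nat i) = (\<Sum>k=1..l. of_nat (n k) * (2 :: complex))"
    using fun_cong[OF n, of h] assms by (simp add: finite_simple_root_eq val)
  then have "2 * complex_of_nat j = of_nat (2 * i + (\<Sum>k=1..l. n k * 2))"
    by (simp add: algebra_simps)
  then have "of_nat (2 * j) = (of_nat (2 * i + (\<Sum>k=1..l. n k * 2)) :: complex)" by simp
  then have "2 * j = 2 * i + (\<Sum>k=1..l. n k * 2)" using of_nat_eq_iff by blast
  then show "i < j" using assms by linarith
next
  assume ij: "i < j"
  have "diff_root l i j = (\<lambda>h. \<Sum>k=1..l. of_nat (of_bool (k \<in> {i..<j})) * finite_simple_root l k h)"
  proof
    fix h
    have "(\<Sum>k=1..l. of_nat (of_bool (k \<in> {i..<j})) * finite_simple_root l k h)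
        = (\<Sum>k\<in>{i..<j}. finite_simple_root l k h)"
      using assms by (intro sum.mono_neutral_cong_right) auto
    then show "diff_root l i j h =
        (\<Sum>k=1..l. of_nat (of_bool (k \<in> {i..<j})) * finite_simple_root l k h)"
      using sum_simple_roots[of i j l h] ij by simp
  qed
  moreover have "diff_root l i j \<in> finite_roots l" using assms unfolding finite_roots_eq by blast
  ultimately show "diff_root l i j \<in> finite_pos_roots l"
    unfolding finite_pos_roots_def by (intro CollectI conjI exI)
qed

definition pos_index :: "nat \<Rightarrow> nat \<Rightarrow> nat \<Rightarrow> int \<Rightarrow> bool" where
  "pos_index l i j m \<longleftrightarrow> i \<in> {1..l+1} \<and> j \<in> {1..l+1} \<and> i \<noteq> j \<and> (m > 0 \<or> m = 0 \<and> i < j)"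

lemma pos_real_coroots_eq: "pos_real_coroots l = {diff_coroot i j m | i j m. pos_index l i j m}"
proof -
  have "pos_real_roots l = {shift_root l (diff_root l i j) m | i j m. pos_index l i j m}"
    unfolding pos_real_roots_def finite_roots_eq pos_index_def
    using diff_root_in_finite_pos_roots_iff by blast
  moreover have "coroot l (shift_root l (diff_root l i j) m) = diff_coroot i j m"
    if "pos_index l i j m" for i j m
    using that by (auto simp: pos_index_def intro!: coroot_shift_diff_root)
  ultimately show ?thesis unfolding pos_real_coroots_def image_def by force
qed

text \<open>Here \<alpha>_0 = \<delta> - \<theta>, and -\<theta> is the difference functional from
  index \<open>l + 1\<close> to index 1.\<close>

lemma simple_coroot_0: "l \<ge> 1 \<Longrightarrow> simple_coroot l 0 = diff_coroot (l + 1) 1 1"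
proof -
  assume "l \<ge> 1"
  have "simple_root l 0 = shift_root l (diff_root l (l + 1) 1) 1"
    by (auto simp: simple_root_def theta_eq shift_root_def diff_root_def fun_eq_iff)
  then show ?thesis using \<open>l \<ge> 1\<close> by (simp add: simple_coroot_def coroot_shift_diff_root)
qed

lemma simple_coroot_pos: "i \<in> {1..l} \<Longrightarrow> simple_coroot l i = diff_coroot i (i + 1) 0"
proof -
  assume i: "i \<in> {1..l}"
  have "simple_root l i = shift_root l (diff_root l i (i + 1)) 0"
    using i by (auto simp: simple_root_def finite_simple_root_eq shift_root_def)
  then show ?thesis using i by (simp add: simple_coroot_def coroot_shift_diff_root)
qed

lemma coroot_2delta_theta:
  "l \<ge> 1 \<Longrightarrow> coroot l (\<lambda>h. 2 * delta l h - theta l h) = diff_coroot (l + 1) 1 2"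
proof -
  assume "l \<ge> 1"
  have "(\<lambda>h. 2 * delta l h - theta l h) = shift_root l (diff_root l (l + 1) 1) 2"
    by (auto simp: theta_eq shift_root_def diff_root_def fun_eq_iff)
  then show ?thesis using \<open>l \<ge> 1\<close> by (simp add: coroot_shift_diff_root)
qed

section \<open>Additive relations between coroots\<close>

lemma diff_coroot_add: "diff_coroot i j m + diff_coroot j k n = diff_coroot i k (m + n)"
  by (auto simp: diff_coroot_def diag_elt_def fun_eq_iff)

text \<open>Both sides are \<open>m c\<close>.\<close>

lemma diff_coroot_same: "diff_coroot i i m = diff_coroot j j m"
  by (auto simp: diff_coroot_def diag_elt_def fun_eq_iff)

lemma diff_coroot_zero: "diff_coroot i i 0 = 0"
  by (auto simp: diff_coroot_def diag_elt_def fun_eq_iff zero_prod_def)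

lemma diff_coroot_multiple: "diff_coroot i i m = cscale (of_int m) (diff_coroot i i 1)"
  by (auto simp: diff_coroot_def diag_elt_def cscale_def fun_eq_iff)

subsection \<open>Values of functionals on coroots\<close>

text \<open>By additivity the values on simple coroots determine those on all real coroots, with c
  worth \<open>a + b l\<close> as the sum of the simple coroots. The pair (a, b) is (1, 0) for the
  fundamental weight and (1, 1) for \<rho>.\<close>

lemma cartan_dual_diff_coroot:
  assumes f: "f \<in> cartan_dual l" and l: "l \<ge> 1"
    and f0: "f (simple_coroot l 0) = a" and fi: "\<And>i. i \<in> {1..l} \<Longrightarrow> f (simple_coroot l i) = b"
    and ij: "i \<in> {1..l+1}" "j \<in> {1..l+1}"
  shows "f (diff_coroot i j m) = b * (of_nat j - of_nat i) + of_int m * (a + b * of_nat l)"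
proof -
  have add: "f (diff_coroot p r (m + n)) = f (diff_coroot p q m) + f (diff_coroot q r n)"
    if "p \<in> {1..l+1}" "q \<in> {1..l+1}" "r \<in> {1..l+1}" for p q r m n
    using f that diff_coroot_in_cartan unfolding diff_coroot_add[of p q m r n, symmetric]
    by (simp add: cartan_dual_def)
  have one: "f (diff_coroot 1 q 0) = b * (of_nat q - 1)" if "q \<in> {1..l+1}" for q
    using that
  proof (induction q)
    case (Suc q)
    show ?case
    proof (cases "q = 0")
      case True
      then show ?thesis using add[of 1 1 1 0 0] by simp
    next
      case False
      then show ?thesis
        using Suc add[of 1 q "Suc q" 0 0] fi[of q] simple_coroot_pos[of q l]
        by (simp add: algebra_simps)
    qed
  qed simp
  have fin: "f (diff_coroot p q 0) = b * (of_nat q - of_nat p)"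
    if "p \<in> {1..l+1}" "q \<in> {1..l+1}" for p q
  proof -
    have "f (diff_coroot p q 0) = f (diff_coroot 1 q 0) - f (diff_coroot 1 p 0)"
      using add[of 1 p q 0 0] that by simp
    also have "\<dots> = b * (of_nat q - of_nat p)"
      unfolding one[OF that(1)] one[OF that(2)] by (simp add: algebra_simps)
    finally show ?thesis .
  qed
  \<comment> \<open>The zeroth simple coroot is the coroot of -\<theta> plus c, which is solved for
    c.\<close>
  have c: "f (diff_coroot 1 1 1) = a + b * of_nat l"
    using add[of "l+1" 1 1 0 1] fin[of "l+1" 1] f0 simple_coroot_0[OF l] by (simp add: algebra_simps)
  have "f (diff_coroot j j m) = of_int m * (a + b * of_nat l)"
    using f diff_coroot_in_cartan[of 1 l 1 1] c
    unfolding diff_coroot_same[of j m 1] diff_coroot_multiple[of 1 m] by (simp add: cartan_dual_def)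
  then show ?thesis using add[of i j j 0 m] ij by (simp add: fin)
qed

text \<open>Serves to bound the height of a sum from below by the number of summands. Real parts are
  taken to compare complex values.\<close>

lemma cartan_dual_sum_list:
  assumes f: "f \<in> cartan_dual l"
    and xs: "\<And>x. x \<in> set xs \<Longrightarrow> x \<in> cartan l \<and> Re (f x) \<ge> 1"
  shows "sum_list xs \<in> cartan l \<and> Re (f (sum_list xs)) \<ge> of_nat (length xs)"
  using xs
proof (induction xs)
  case Nil
  have z: "0 \<in> cartan l" using diff_coroot_in_cartan[of 1 l 1 0] by (simp add: diff_coroot_zero)
  then have "f (0 + 0) = f 0 + f 0" using f unfolding cartan_dual_def by blast
  then show ?case using z by simp
next
  case (Cons x xs)
  then have "f (x + sum_list xs) = f x + f (sum_list xs)"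
    using f by (simp add: cartan_dual_def)
  with Cons show ?case using cartan_add[of x l "sum_list xs"] by fastforce
qed

subsection \<open>Spans and decompositions\<close>

text \<open>Partial sums of simple coroots give E_1 - E_q, their differences give E_p - E_q, and the
  zeroth simple coroot plus the coroot of \<theta> gives c.\<close>

lemma diff_coroot_in_span:
  assumes l: "l \<ge> 1" and ij: "i \<in> {1..l+1}" "j \<in> {1..l+1}"
  shows "diff_coroot i j m \<in> rat_space.span (simple_coroot l ` {0..l})" (is "_ \<in> ?S")
proof -
  have simple: "simple_coroot l i \<in> ?S" if "i \<le> l" for i
    using that by (intro rat_space.span_base) auto
  have one: "diff_coroot 1 q 0 \<in> ?S" if "q \<in> {1..l+1}" for q
    using that
  proof (induction q)
    case (Suc q)
    show ?case
    proof (cases "q = 0")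
      case True
      then show ?thesis using diff_coroot_zero[of 1] rat_space.span_zero by simp
    next
      case False
      then show ?thesis
        using Suc rat_space.span_add[OF _ simple[of q], of "diff_coroot 1 q 0"]
          simple_coroot_pos[of q l] diff_coroot_add[of 1 q 0 "Suc q" 0] by simp
    qed
  qed simp
  have fin: "diff_coroot p q 0 \<in> ?S" if "p \<in> {1..l+1}" "q \<in> {1..l+1}" for p q
  proof -
    have "diff_coroot p q 0 = diff_coroot 1 q 0 - diff_coroot 1 p 0"
      using diff_coroot_add[of 1 p 0 q 0] by (simp add: algebra_simps)
    then show ?thesis using one that rat_space.span_diff by metis
  qed
  have "diff_coroot 1 1 1 = simple_coroot l 0 + diff_coroot 1 (l+1) 0"
    using diff_coroot_add[of 1 "l+1" 0 1 1] simple_coroot_0[OF l] by (simp add: algebra_simps)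
  then have "diff_coroot 1 1 1 \<in> ?S"
    using rat_space.span_add simple fin[of 1 "l+1"] by simp
  then have "cscale (of_rat (of_int m)) (diff_coroot 1 1 1) \<in> ?S"
    by (rule rat_space.span_scale)
  then have "diff_coroot j j m \<in> ?S"
    using diff_coroot_multiple[of 1 m] diff_coroot_same[of j m 1] by simp
  then show ?thesis
    using rat_space.span_add[OF fin[OF ij]] diff_coroot_add[of i j 0 j m] by fastforce
qed

text \<open>For the weight of the theorem this is the set of integral positive coroots.\<close>

definition even_coroots :: "nat \<Rightarrow> aff set" where
  "even_coroots l = {diff_coroot i j m | i j m. pos_index l i j m \<and> even m}"

text \<open>For \<open>m = 0\<close> the coroot of \<alpha>_i splits off. If subtracting 2c leaves a
  positive coroot, 2c splits off as a sum of two coroots. Otherwise a positive finite coroot splits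
  off on one side.\<close>

lemma even_coroots_decompose:
  assumes l: "l \<ge> 1" and ij: "pos_index l i j m" and m: "even m"
    and simple: "\<not> (m = 0 \<and> j = i + 1)" "\<not> (i = l + 1 \<and> j = 1 \<and> m = 2)"
  shows "\<exists>xs. length xs \<ge> 2 \<and> set xs \<subseteq> even_coroots l \<and> diff_coroot i j m = sum_list xs"
proof -
  have two: ?thesis
    if "pos_index l i k p" "even p" "pos_index l k j q" "even q" "m = p + q" for k p q
    using that diff_coroot_add[of i k p j q]
    by (intro exI[of _ "[diff_coroot i k p, diff_coroot k j q]"]) (auto simp: even_coroots_def)
  have ij': "i \<in> {1..l+1}" "j \<in> {1..l+1}" "i \<noteq> j" using ij by (auto simp: pos_index_def)
  obtain n where n: "m = 2 * n" using m by blast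
  \<comment> \<open>A positive even \<open>m\<close> is at least 2, and lowering it by 2 keeps the
    coroot positive unless \<open>m = 2\<close> and \<open>i > j\<close>.\<close>
  consider "m = 0" | "pos_index l i j (m - 2)" "m \<noteq> 0" | "m = 2" "i > j"
    using ij n by (auto simp: pos_index_def) linarith
  then show ?thesis
  proof cases
    case 1
    then show ?thesis using two[of "i + 1" 0 0] ij simple by (auto simp: pos_index_def)
  next
    case 2
    \<comment> \<open>\<open>2c = \<alpha>\<^sub>1\<^sup>\<or> + (2\<delta> - \<alpha>\<^sub>1)\<^sup>\<or>\<close>\<close>
    have "diff_coroot i j m = diff_coroot i j (m - 2) + (diff_coroot 1 2 0 + diff_coroot 2 1 2)"
      using diff_coroot_add[of i j "m - 2" j 2] diff_coroot_add[of 1 2 0 1 2]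
        diff_coroot_same[of 1 2 j] by simp
    then show ?thesis
      using 2 l m
      by (intro exI[of _ "[diff_coroot i j (m - 2), diff_coroot 1 2 0, diff_coroot 2 1 2]"])
        (fastforce simp: even_coroots_def pos_index_def)
  next
    case 3
    show ?thesis
    proof (cases "i = l + 1")
      case True
      \<comment> \<open>E_i - E_j + 2c = (E_{l+1} - E_1 + 2c) + (E_1 - E_j), where \<open>j\<close>
        differs from 1 because the coroot of 2\<delta> - \<theta> is excluded.\<close>
      then show ?thesis using two[of 1 2 0] 3 ij' simple by (auto simp: pos_index_def)
    next
      case False
      \<comment> \<open>E_i - E_j + 2c = (E_i - E_{l+1}) + (E_{l+1} - E_j + 2c).\<close>
      then show ?thesis using two[of "l + 1" 0 2] 3 ij' by (auto simp: pos_index_def)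
    qed
  qed
qed

section \<open>Admissibility and indecomposable integral coroots of the weight\<close>

theorem lemma4p1:
  fixes l :: nat and \<Lambda>0 \<rho> \<mu> :: "aff \<Rightarrow> complex"
  assumes "l \<ge> 2" and "even l"
    and "is_Lambda0 l \<Lambda>0"
    and "is_rho l \<rho>"
    and "\<mu> = (\<lambda>h. - (1 / 2) * (of_nat l + 1) * \<Lambda>0 h)"
  shows "admissible l \<rho> \<mu> \<and>
    integral_simple_coroots l \<mu> =
      insert (coroot l (\<lambda>h. 2 * delta l h - theta l h)) (simple_coroot l ` {1..l})"
proof -
  have l: "l \<ge> 1" using assms(1) by simp
  have \<Lambda>: "\<Lambda>0 \<in> cartan_dual l" and \<rho>: "\<rho> \<in> cartan_dual l"
    using assms(3,4) by (auto simp: is_Lambda0_def is_rho_def)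
  have \<mu>: "\<mu> \<in> cartan_dual l"
    using \<Lambda> unfolding assms(5) cartan_dual_def by (auto simp: ring_distribs add_divide_distrib)
  have \<mu>\<rho>: "\<mu> + \<rho> \<in> cartan_dual l"
    using \<mu> \<rho> unfolding cartan_dual_def by (auto simp: algebra_simps)
  have \<mu>_val: "\<mu> (diff_coroot i j m) = - (of_int ((int l + 1) * m) / 2)"
    if "i \<in> {1..l+1}" "j \<in> {1..l+1}" for i j m
    using cartan_dual_diff_coroot[OF \<Lambda> l _ _ that, of 1 0 m] assms(3)
    by (simp add: assms(5) is_Lambda0_def)
  have \<mu>\<rho>_val: "(\<mu> + \<rho>) (diff_coroot i j m) = of_int (2 * (int j - int i) + (int l + 1) * m) / 2"
    if "i \<in> {1..l+1}" "j \<in> {1..l+1}" for i j m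
  proof -
    have "\<rho> (diff_coroot i j m) = of_nat j - of_nat i + of_int m * (1 + of_nat l)"
      using cartan_dual_diff_coroot[OF \<rho> l _ _ that, of 1 1 m] assms(4) by (simp add: is_rho_def)
    then have "(\<mu> + \<rho>) (diff_coroot i j m)
        = - (of_int ((int l + 1) * m) / 2) + (of_nat j - of_nat i + of_int m * (1 + of_nat l))"
      by (simp only: plus_fun_apply \<mu>_val[OF that])
    then show ?thesis by (simp add: field_simps)
  qed
  have half_int: "even k" if "of_int k / 2 \<in> (\<int> :: complex set)" for k :: int
  proof -
    from that obtain n where "of_int k / 2 = (of_int n :: complex)" by (auto elim: Ints_cases)
    then have "of_int k = (of_int (2 * n) :: complex)" by simp
    then show ?thesis using of_int_eq_iff by (metis dvd_triv_left)
  qed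
  have integral: "\<mu> (diff_coroot i j m) \<in> \<int> \<longleftrightarrow> even m"
    if "i \<in> {1..l+1}" "j \<in> {1..l+1}" for i j m
  proof
    assume "\<mu> (diff_coroot i j m) \<in> \<int>"
    then have "of_int ((int l + 1) * m) / 2 \<in> (\<int> :: complex set)"
      unfolding \<mu>_val[OF that] by (simp only: minus_in_Ints_iff)
    then have "even ((int l + 1) * m)" by (rule half_int)
    then show "even m" using assms(2) by simp
  next
    assume "even m"
    then obtain n where "m = 2 * n" by blast
    then have "\<mu> (diff_coroot i j m) = of_int (- ((int l + 1) * n))" by (simp add: \<mu>_val[OF that])
    then show "\<mu> (diff_coroot i j m) \<in> \<int>" using Ints_of_int by metis
  qed
  \<comment> \<open>Twice the value of \<lambda> + \<rho>, to stay within the integers. For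
    \<open>m \<ge> 2\<close> the second term is at least \<open>2 l + 2\<close>, while the first is
    at least \<open>- 2 l\<close>.\<close>
  have height: "2 * (int j - int i) + (int l + 1) * m \<ge> 2"
    if "pos_index l i j m" "m \<noteq> 1" for i j m
  proof (cases "m = 0")
    case False
    then have "(int l + 1) * m \<ge> (int l + 1) * 2"
      using that by (intro mult_left_mono) (auto simp: pos_index_def)
    then show ?thesis using that by (auto simp: pos_index_def)
  qed (use that in \<open>auto simp: pos_index_def\<close>)
  have dominant: "(\<mu> + \<rho>) (diff_coroot i j m) \<notin> \<int>\<^sub>\<le>\<^sub>0" if ijm: "pos_index l i j m" for i j m
  proof
    assume neg: "(\<mu> + \<rho>) (diff_coroot i j m) \<in> \<int>\<^sub>\<le>\<^sub>0"
    have val: "(\<mu> + \<rho>) (diff_coroot i j m) = of_int (2 * (int j - int i) + (int l + 1) * m) / 2"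
      using ijm by (intro \<mu>\<rho>_val) (auto simp: pos_index_def)
    have "even (2 * (int j - int i) + (int l + 1) * m)"
      using neg nonpos_Ints_subset_Ints unfolding val by (intro half_int) blast
    \<comment> \<open>For \<open>m = 1\<close> the number would be odd, because \<open>l + 1\<close>
      is odd.\<close>
    then have "m \<noteq> 1" using assms(2) by auto
    with height[OF ijm] have "2 * (int j - int i) + (int l + 1) * m \<ge> 2" by simp
    moreover from neg obtain n where n: "(\<mu> + \<rho>) (diff_coroot i j m) = of_int n" "n \<le> 0"
      by (auto elim: nonpos_Ints_cases)
    then have "of_int (2 * (int j - int i) + (int l + 1) * m) = (of_int (2 * n) :: complex)"
      unfolding val by simp
    then have "2 * (int j - int i) + (int l + 1) * m = 2 * n" using of_int_eq_iff by blast
    ultimately show False using n(2) by linarith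
  qed
  have span: "rat_space.span (integral_coroots l \<mu>) = rat_space.span (simple_coroot l ` {0..l})"
    unfolding rat_space.span_eq
  proof
    show "integral_coroots l \<mu> \<subseteq> rat_space.span (simple_coroot l ` {0..l})"
      using diff_coroot_in_span[OF l] unfolding integral_coroots_def real_coroots_eq by blast
    have int: "diff_coroot i j m \<in> rat_space.span (integral_coroots l \<mu>)"
      if "i \<in> {1..l+1}" "j \<in> {1..l+1}" "i \<noteq> j" "even m" for i j m
    proof (rule rat_space.span_base)
      show "diff_coroot i j m \<in> integral_coroots l \<mu>"
        unfolding integral_coroots_def real_coroots_eq using that integral by blast
    qed
    have "simple_coroot l i \<in> rat_space.span (integral_coroots l \<mu>)" if "i \<le> l" for i
    proof (cases "i = 0")
      case True
      \<comment> \<open>This coroot has \<open>m = 1\<close> and is not integral, but it is the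
        average of two integral ones, with \<open>m = 2\<close> and \<open>m = 0\<close>.\<close>
      have "simple_coroot l 0 = cscale (of_rat (1 / 2)) (diff_coroot (l+1) 1 2 + diff_coroot (l+1) 1 0)"
        unfolding simple_coroot_0[OF l]
        by (auto simp: cscale_def diff_coroot_def diag_elt_def fun_eq_iff of_rat_divide)
      then show ?thesis
        using True l int[of "l+1" 1] rat_space.span_scale rat_space.span_add by auto
    next
      case False
      then show ?thesis using that int[of i "i+1" 0] simple_coroot_pos[of i l] by simp
    qed
    then show "simple_coroot l ` {0..l} \<subseteq> rat_space.span (integral_coroots l \<mu>)" by auto
  qed
  have "admissible l \<rho> \<mu>"
    using \<mu> dominant span unfolding admissible_def pos_real_coroots_eq by blast
  moreover have pos: "pos_integral_coroots l \<mu> = even_coroots l"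
  proof -
    have "pos_integral_coroots l \<mu> = {x \<in> pos_real_coroots l. \<mu> x \<in> \<int>}"
      unfolding pos_integral_coroots_def integral_coroots_def real_coroots_eq pos_real_coroots_eq
        pos_index_def by blast
    also have "\<dots> = {x. \<exists>i j m. x = diff_coroot i j m \<and> pos_index l i j m \<and>
        \<mu> (diff_coroot i j m) \<in> \<int>}"
      unfolding pos_real_coroots_eq by blast
    also have "\<dots> = even_coroots l"
      unfolding even_coroots_def
      by (intro Collect_cong iff_exI conj_cong refl) (simp add: integral pos_index_def)
    finally show ?thesis .
  qed
  \<comment> \<open>The assumption \<open>ht\<close> says that \<lambda> + \<rho> is 1 at
    \<open>x\<close>, whereas a sum of at least two integral positive coroots has value at least
    2.\<close>
  have indecomposable: "x \<in> integral_simple_coroots l \<mu>"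
    if x: "x = diff_coroot i j m" "pos_index l i j m" "even m"
      and ht: "2 * (int j - int i) + (int l + 1) * m = 2" for x i j m
  proof -
    have "False" if xs: "length xs \<ge> 2" "set xs \<subseteq> even_coroots l" "x = sum_list xs" for xs
    proof -
      have "y \<in> cartan l \<and> Re ((\<mu> + \<rho>) y) \<ge> 1" if "y \<in> set xs" for y
      proof -
        obtain p q n where y: "y = diff_coroot p q n" "pos_index l p q n" "even n"
          using \<open>y \<in> set xs\<close> xs(2) unfolding even_coroots_def by blast
        then have pq: "p \<in> {1..l+1}" "q \<in> {1..l+1}" by (auto simp: pos_index_def)
        have "n \<noteq> 1" using y(3) by auto
        then have "real_of_int (2 * (int q - int p) + (int l + 1) * n) \<ge> 2"
          using height[OF y(2)] by linarith
        then show ?thesis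
          unfolding y(1) \<mu>\<rho>_val[OF pq] using diff_coroot_in_cartan[OF pq]
          by (simp del: of_int_add of_int_mult of_int_diff)
      qed
      then have "Re ((\<mu> + \<rho>) x) \<ge> 2" using cartan_dual_sum_list[OF \<mu>\<rho>, of xs] xs by force
      moreover have "(\<mu> + \<rho>) x = 1"
        using x \<mu>\<rho>_val[of i j m] unfolding ht by (simp add: pos_index_def)
      ultimately show False by (simp del: plus_fun_apply)
    qed
    then show ?thesis
      using x unfolding integral_simple_coroots_def pos even_coroots_def by blast
  qed
  have "integral_simple_coroots l \<mu> =
      insert (diff_coroot (l + 1) 1 2) ((\<lambda>i. diff_coroot i (i + 1) 0) ` {1..l})"
  proof (intro equalityI subsetI)
    fix x assume x: "x \<in> integral_simple_coroots l \<mu>"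
    then obtain i j m where ijm: "x = diff_coroot i j m" "pos_index l i j m" "even m"
      unfolding integral_simple_coroots_def pos even_coroots_def by blast
    have "m = 0 \<and> j = i + 1 \<or> i = l + 1 \<and> j = 1 \<and> m = 2"
      using even_coroots_decompose[OF l ijm(2,3)] x
      unfolding integral_simple_coroots_def pos ijm(1) by blast
    then show "x \<in> insert (diff_coroot (l + 1) 1 2) ((\<lambda>i. diff_coroot i (i + 1) 0) ` {1..l})"
      using ijm by (auto simp: pos_index_def)
  next
    fix x assume "x \<in> insert (diff_coroot (l + 1) 1 2) ((\<lambda>i. diff_coroot i (i + 1) 0) ` {1..l})"
    then consider "x = diff_coroot (l + 1) 1 2" | i where "i \<in> {1..l}" "x = diff_coroot i (i + 1) 0"
      by blast
    then show "x \<in> integral_simple_coroots l \<mu>"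
      \<comment> \<open>The doubled height is \<open>- 2 l + 2 (l + 1) = 2\<close> in the first case
        and \<open>2 * 1\<close> in the second.\<close>
      by cases (use l in \<open>auto intro!: indecomposable simp: pos_index_def\<close>)
  qed
  then have "integral_simple_coroots l \<mu> =
      insert (coroot l (\<lambda>h. 2 * delta l h - theta l h)) (simple_coroot l ` {1..l})"
    unfolding coroot_2delta_theta[OF l] by (simp add: simple_coroot_pos)
  ultimately show ?thesis by blast
qed

end
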